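(* Let $\mathcal{A}$ be a complex Banach $*$-algebra with identity, and let $a,b\in\mathcal{A}$ be core invertible. If $ab=ba$ and $a^*b=ba^*$, then the following are equivalent: (1) $a+b$ is core invertible and $a^{\pi}(a+b)^{\mathrm{core}}a=0$. (2) $1+a^{\mathrm{core}}b$ is core invertible and $(1+a^{\mathrm{core}}b)^{\pi}a(1-aa^{\mathrm{core}})=0$.
   Context: An involution on a Banach algebra $\mathcal{A}$ is a map $*:\mathcal{A}\to\mathcal{A}$ with $(x+y)^*=x^*+y^*$, $(xy)^*=y^*x^*$, $(x^* )^*=x$ for all $x,y$; a Banach algebra with an involution is called a Banach $*$-algebra. An element $a\in\mathcal{A}$ is group invertible if there is $x\in\mathcal{A}$ with $axa=a$, $xax=x$, $ax=xa$; such $x$ is unique and is denoted $a^{\#}$, and then $a^{\pi}:=1-aa^{\#}$. An element $a$ is core invertible if there is $x\in\mathcal{A}$ with $xa^2=a$, $ax^2=x$, $(ax)^*=ax$; such $x$ is unique and is denoted $a^{\mathrm{core}}$. Every core invertible element is group invertible, so $a^{\#}$ and $a^{\pi}$ make sense for such $a$. *)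

theory Defs
  imports Complex_Main
begin

text \<open>
  The distribution has real but no complex normed spaces; the complex scalar multiplication
  is added on top of the real one. The class \<^class>\<open>real_normed_algebra_1\<close> is not used as
  the base because it requires \<open>norm 1 = 1\<close> and \<open>0 \<noteq> 1\<close>.
\<close>

class complex_banach_algebra_1 = real_normed_algebra + monoid_mult + banach +
  fixes scaleC :: "complex \<Rightarrow> 'a \<Rightarrow> 'a" (infixr "*\<^sub>C" 75)
  assumes scaleR_scaleC: "scaleR r x = complex_of_real r *\<^sub>C x"
    and scaleC_add_right: "c *\<^sub>C (x + y) = c *\<^sub>C x + c *\<^sub>C y"
    and scaleC_add_left: "(c + d) *\<^sub>C x = c *\<^sub>C x + d *\<^sub>C x"
    and scaleC_scaleC: "c *\<^sub>C d *\<^sub>C x = (c * d) *\<^sub>C x"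
    and scaleC_one: "1 *\<^sub>C x = x"
    and mult_scaleC_left: "(c *\<^sub>C x) * y = c *\<^sub>C (x * y)"
    and mult_scaleC_right: "x * (c *\<^sub>C y) = c *\<^sub>C (x * y)"
    and norm_scaleC: "norm (c *\<^sub>C x) = cmod c * norm x"

text \<open>
  The involution is only required to be additive, anti-multiplicative and involutive:
  neither conjugate-linearity nor continuity is assumed.
\<close>

class complex_banach_star_algebra_1 = complex_banach_algebra_1 +
  fixes star :: "'a \<Rightarrow> 'a" ("_\<^sup>\<star>" [1000] 999)
  assumes star_add: "(x + y)\<^sup>\<star> = x\<^sup>\<star> + y\<^sup>\<star>"
    and star_mult: "(x * y)\<^sup>\<star> = y\<^sup>\<star> * x\<^sup>\<star>"
    and star_star: "(x\<^sup>\<star>)\<^sup>\<star> = x"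

definition is_group_inverse :: "'a::complex_banach_algebra_1 \<Rightarrow> 'a \<Rightarrow> bool" where
  "is_group_inverse a x \<longleftrightarrow> a * x * a = a \<and> x * a * x = x \<and> a * x = x * a"

definition group_invertible :: "'a::complex_banach_algebra_1 \<Rightarrow> bool" where
  "group_invertible a \<longleftrightarrow> (\<exists>x. is_group_inverse a x)"

definition group_inv :: "'a::complex_banach_algebra_1 \<Rightarrow> 'a" where
  "group_inv a = (THE x. is_group_inverse a x)"

definition spectral_idem :: "'a::complex_banach_algebra_1 \<Rightarrow> 'a" ("_\<^sup>\<pi>" [1000] 999) where
  "a\<^sup>\<pi> = 1 - a * group_inv a"

definition is_core_inverse :: "'a::complex_banach_star_algebra_1 \<Rightarrow> 'a \<Rightarrow> bool" where
  "is_core_inverse a x \<longleftrightarrow> x * a ^ 2 = a \<and> a * x ^ 2 = x \<and> (a * x)\<^sup>\<star> = a * x"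

definition core_invertible :: "'a::complex_banach_star_algebra_1 \<Rightarrow> bool" where
  "core_invertible a \<longleftrightarrow> (\<exists>x. is_core_inverse a x)"

definition core_inv :: "'a::complex_banach_star_algebra_1 \<Rightarrow> 'a" where
  "core_inv a = (THE x. is_core_inverse a x)"

lemma is_group_inverse_unique:
  assumes "is_group_inverse a x" and "is_group_inverse a y"
  shows "x = y"
proof -
  have x: "a * x * a = a" "x * a * x = x" "a * x = x * a"
    and y: "a * y * a = a" "y * a * y = y" "a * y = y * a"
    using assms by (auto simp: is_group_inverse_def)
  have "x = x * a * y * a * x"
    using x y by (metis mult.assoc)
  also have "x * a * y * a * x = y * a * x"
    using x y by (metis mult.assoc)
  also have "y * a * x = y"
    using x y by (metis mult.assoc)
  finally show ?thesis .
qed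

lemma group_inv_eq: "is_group_inverse a x \<Longrightarrow> group_inv a = x"
  unfolding group_inv_def by (blast intro: the_equality is_group_inverse_unique)

lemma is_group_inverse_group_inv: "group_invertible a \<Longrightarrow> is_group_inverse a (group_inv a)"
  unfolding group_invertible_def using group_inv_eq by blast

lemma is_core_inverse_regular:
  assumes "is_core_inverse a x"
  shows "a * x * a = a" and "x * a * x = x"
proof -
  have x: "x * (a * a) = a" "a * (x * x) = x"
    using assms by (auto simp: is_core_inverse_def power2_eq_square)
  have "a * x * a = a * x * (x * (a * a))" by (simp only: x)
  also have "\<dots> = (a * (x * x)) * (a * a)" by (simp only: mult.assoc)
  also have "\<dots> = a" by (simp only: x)
  finally show "a * x * a = a" .
  have "x * a * x = x * a * (a * (x * x))" by (simp only: x)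
  also have "\<dots> = (x * (a * a)) * (x * x)" by (simp only: mult.assoc)
  also have "\<dots> = x" by (simp only: x)
  finally show "x * a * x = x" .
qed

lemma is_core_inverse_unique:
  assumes "is_core_inverse a x" and "is_core_inverse a y"
  shows "x = y"
proof -
  have x: "x * (a * a) = a" "a * (x * x) = x" "(a * x)\<^sup>\<star> = a * x"
    and y: "y * (a * a) = a" "a * (y * y) = y" "(a * y)\<^sup>\<star> = a * y"
    using assms by (auto simp: is_core_inverse_def power2_eq_square)
  note rx = is_core_inverse_regular[OF assms(1)]
  note ry = is_core_inverse_regular[OF assms(2)]
  have "a * x = (a * y * a) * x" by (simp only: ry)
  also have "\<dots> = (a * y) * (a * x)" by (simp only: mult.assoc)
  also have "\<dots> = ((a * x) * (a * y))\<^sup>\<star>" by (simp only: star_mult[of "a * x" "a * y"] x y)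
  also have "(a * x) * (a * y) = (a * x * a) * y" by (simp only: mult.assoc)
  also have "(\<dots>)\<^sup>\<star> = a * y" by (simp only: rx y)
  finally have ax: "a * x = a * y" .
  have "y = a * (a * (y * y) * y)" by (simp only: y)
  also have "\<dots> = (a * a) * (y * (y * y))" by (simp only: mult.assoc)
  finally have "x * y = x * ((a * a) * (y * (y * y)))" by (rule arg_cong)
  also have "\<dots> = (x * (a * a)) * (y * (y * y))" by (simp only: mult.assoc)
  also have "\<dots> = (a * (y * y)) * y" by (simp only: x mult.assoc)
  finally have xy: "x * y = y * y" by (simp only: y)
  have "x * a = (x * y) * (a * a)" by (simp only: y mult.assoc)
  also have "\<dots> = y * a" unfolding xy by (simp only: y mult.assoc)
  finally have xa: "x * a = y * a" .
  have "x = x * (a * x)" using rx by (simp only: mult.assoc)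
  also have "\<dots> = (x * a) * y" by (simp only: ax mult.assoc)
  also have "\<dots> = y" by (simp only: xa ry)
  finally show ?thesis .
qed

lemma core_inv_eq: "is_core_inverse a x \<Longrightarrow> core_inv a = x"
  unfolding core_inv_def by (blast intro: the_equality is_core_inverse_unique)

lemma is_core_inverse_core_inv: "core_invertible a \<Longrightarrow> is_core_inverse a (core_inv a)"
  unfolding core_invertible_def using core_inv_eq by blast

lemma core_invertible_imp_group_invertible:
  assumes "core_invertible a"
  shows "group_invertible a"
proof -
  obtain x where "is_core_inverse a x"
    using assms by (auto simp: core_invertible_def)
  then have x: "x * (a * a) = a" "a * (x * x) = x"
    and r: "a * x * a = a" "x * a * x = x"
    using is_core_inverse_regular by (auto simp: is_core_inverse_def power2_eq_square)
  have l: "a * (x * x * a) = x * a" using x by (metis mult.assoc)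
  moreover have "x * x * a * a = x * a" using x by (metis mult.assoc)
  ultimately have "is_group_inverse a (x * x * a)"
    unfolding is_group_inverse_def using x r by (metis mult.assoc)
  then show ?thesis by (auto simp: group_invertible_def)
qed

end

theory Submission
  imports Defs
begin

text \<open>
  Let \<open>x\<close> be the core inverse of \<open>a\<close> and \<open>p = a * x\<close>, a projection with \<open>p * a = a\<close>.
  Since \<open>b\<close> commutes with \<open>a\<close> and its adjoint, it commutes with \<open>x\<close> and \<open>p\<close>. In the Peirce
  decomposition with respect to \<open>p\<close>, the matrices of \<open>a\<close>, \<open>b\<close>, \<open>a + b\<close> and \<open>c = 1 + x * b\<close> are
  \<open>[a1, a2; 0, 0]\<close>, \<open>[b1, 0; 0, b4]\<close>, \<open>[a1 c1, a2; 0, b4]\<close> and \<open>[c1, 0; 0, 1]\<close>, where \<open>a1\<close>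
  is invertible in the corner and commutes with \<open>c1\<close>. Condition (1) says that \<open>a + b\<close> has an upper
  triangular core inverse, condition (2) that \<open>c1\<close> is core invertible and \<open>a2\<close> lies in its range.
  With \<open>d1\<close> and \<open>y4\<close> the core inverses of \<open>c1\<close> and \<open>b4\<close>, the core inverse of
  \<open>a + b\<close> is then \<open>[x d1, - x d1 a2 y4; 0, y4]\<close>.
\<close>

section \<open>Rewriting in right-nested products; the involution at 0, 1 and differences\<close>

text \<open>Once \<open>mult.assoc\<close> has nested products to the right, an equation for
  \<open>u * v\<close> no longer matches inside a longer product; this form and the next restore the
  match.\<close>

lemma mult_eq_assoc:
  fixes u :: "'a::semigroup_mult"
  assumes "u * v = w"
  shows "u * (v * z) = w * z"
  using assms by (simp add: mult.assoc[symmetric])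

lemma mult_eq_assoc3:
  fixes u :: "'a::semigroup_mult"
  assumes "u * (v * t) = w"
  shows "u * (v * (t * z)) = w * z"
  using assms by (simp add: mult.assoc[symmetric])

lemma star_zero: "(0::'a::complex_banach_star_algebra_1)\<^sup>\<star> = 0"
  using star_add[of "0::'a" 0] by simp

lemma star_diff: "(x - y)\<^sup>\<star> = x\<^sup>\<star> - (y::'a::complex_banach_star_algebra_1)\<^sup>\<star>"
  using star_add[of "x - y" y] by (simp add: algebra_simps)

lemma star_one: "(1::'a::complex_banach_star_algebra_1)\<^sup>\<star> = 1"
  by (metis mult_1_left mult_1_right star_mult star_star)

section \<open>Spectral idempotent and commutant of a core inverse\<close>

text \<open>The group inverse of \<open>a\<close> is \<open>x * x * a\<close>, and
  \<open>a * (x * x) = x\<close>.\<close>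

lemma is_core_inverse_spectral_idem:
  fixes a x :: "'a::complex_banach_star_algebra_1"
  assumes "is_core_inverse a x"
  shows "a\<^sup>\<pi> = 1 - x * a"
proof -
  have x: "x * (a * a) = a" "a * (x * x) = x"
    using assms by (auto simp: is_core_inverse_def power2_eq_square)
  note r = is_core_inverse_regular[OF assms]
  have l: "a * (x * x * a) = x * a" using x by (metis mult.assoc)
  moreover have "x * x * a * a = x * a" using x by (metis mult.assoc)
  ultimately have "is_group_inverse a (x * x * a)"
    unfolding is_group_inverse_def using x r by (metis mult.assoc)
  then have "group_inv a = x * x * a" by (rule group_inv_eq)
  with l show ?thesis by (simp add: spectral_idem_def)
qed

text \<open>The idempotent \<open>f = x * a\<close> satisfies \<open>f * a = a = a * f\<close>.
  Moving \<open>e\<close> past \<open>a\<close> therefore turns both \<open>e * f\<close> and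
  \<open>f * e\<close> into \<open>f * e * f\<close>.\<close>

lemma is_core_inverse_commute_idem:
  fixes a x e :: "'a::complex_banach_star_algebra_1"
  assumes "is_core_inverse a x" and e: "e * a = a * e"
  shows "e * (x * a) = (x * a) * e"
proof -
  have x: "x * (a * a) = a" "a * (x * x) = x"
    using assms by (auto simp: is_core_inverse_def power2_eq_square)
  note r = is_core_inverse_regular[OF assms(1)]
  have "e * (x * a) = e * (a * (x * x)) * a" by (simp add: x mult.assoc)
  also have "\<dots> = a * e * (x * x * a)" by (simp only: e[symmetric] mult.assoc)
  also have "\<dots> = x * (a * a) * e * (x * x * a)" by (simp only: x)
  also have "\<dots> = x * a * e * (a * (x * x)) * a"
    by (simp only: e mult_eq_assoc[OF e] mult.assoc)
  also have "\<dots> = x * (a * e) * (x * a)" by (simp only: x e mult_eq_assoc[OF e] mult.assoc)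
  also have "\<dots> = x * e * (a * x * a)" by (simp only: e mult_eq_assoc[OF e] mult.assoc)
  also have "\<dots> = x * a * e" unfolding r by (simp only: e mult.assoc)
  finally show ?thesis .
qed

text \<open>The core inverse depends on the adjoint through the projection \<open>a * x\<close>, so
  \<open>e\<close> must first be shown to commute with it; this is where the condition on the
  adjoint of \<open>e\<close> enters.\<close>

lemma is_core_inverse_commute:
  fixes a x e :: "'a::complex_banach_star_algebra_1"
  assumes "is_core_inverse a x" and e: "e * a = a * e" and es: "e\<^sup>\<star> * a = a * e\<^sup>\<star>"
  shows "e * x = x * e"
proof -
  have x: "x * (a * a) = a" "a * (x * x) = x" and s: "(a * x)\<^sup>\<star> = a * x"
    using assms by (auto simp: is_core_inverse_def power2_eq_square)
  note r = is_core_inverse_regular[OF assms(1)]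
  \<comment> \<open>The range of \<open>a * x\<close> is that of \<open>a\<close>, hence invariant
    under every \<open>f\<close> commuting with \<open>a\<close>. A self-adjoint projection with
    range invariant under \<open>e\<close> and its adjoint commutes with \<open>e\<close>.\<close>
  have inv: "(a * x) * f * (a * x) = f * (a * x)" if "f * a = a * f" for f
  proof -
    have "f * (a * x) = a * f * x" by (simp only: that[symmetric] mult.assoc)
    also have "\<dots> = a * x * (a * f) * x" by (simp only: r mult.assoc[symmetric])
    also have "\<dots> = (a * x) * f * (a * x)" by (simp only: that[symmetric] mult.assoc)
    finally show ?thesis by simp
  qed
  have "(a * x) * e * (a * x) = ((a * x) * e\<^sup>\<star> * (a * x))\<^sup>\<star>"
    by (simp only: star_mult[of _ "a * x"] star_mult[of "a * x"] s star_star)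
      (simp only: mult.assoc)
  also have "\<dots> = (a * x) * e"
    by (simp only: inv[OF es] star_mult[of _ "a * x"] s star_star)
  finally have p: "(a * x) * e = e * (a * x)" using inv[OF e] by simp
  have "x * e = x * ((a * x) * e)" using r by (simp only: mult.assoc[symmetric])
  also have "\<dots> = x * a * e * x" unfolding p by (simp only: e mult.assoc[symmetric])
  also have "\<dots> = (x * a) * e * (a * (x * x))" by (simp only: x)
  also have "\<dots> = x * (a * (e * a)) * (x * x)" by (simp only: mult.assoc)
  also have "\<dots> = x * (a * a) * e * (x * x)" by (simp only: e mult.assoc)
  also have "\<dots> = e * (a * (x * x))" by (simp only: x e[symmetric] mult.assoc)
  finally show ?thesis by (simp only: x)
qed

section \<open>Peirce decomposition with respect to \<open>a * x\<close>\<close>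

context
  fixes a b x p q c :: "'a::complex_banach_star_algebra_1"
  assumes a: "is_core_inverse a x"
    and ab: "a * b = b * a" and sab: "a\<^sup>\<star> * b = b * a\<^sup>\<star>"
  defines "p \<equiv> a * x" and "q \<equiv> 1 - a * x" and "c \<equiv> 1 + x * b"
begin

private lemma xaa: "x * (a * a) = a" and axx: "a * (x * x) = x" and ps: "p\<^sup>\<star> = p"
  using a by (auto simp: is_core_inverse_def power2_eq_square p_def)

private lemma axa: "a * (x * a) = a" and xax: "x * (a * x) = x"
  using is_core_inverse_regular[OF a] by (auto simp: mult.assoc)

private lemma ax: "a * x = p" by (simp add: p_def)

private lemma pa: "p * a = a" and px: "p * x = x" and xp: "x * p = x" and pp: "p * p = p"
  and xap: "x * (a * p) = p"
  by (simp_all add: p_def mult.assoc xaa axx axa xax mult_eq_assoc3[OF xaa])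

private lemma qdef: "q = 1 - p" by (simp add: p_def q_def)

private lemma qs: "q\<^sup>\<star> = q" by (simp add: qdef star_diff star_one ps)

private lemma qa: "q * a = 0" and qx: "q * x = 0" and xq: "x * q = 0" and qq: "q * q = q"
  and pq: "p * q = 0"
  by (simp_all add: qdef algebra_simps pa px xp pp)

private lemma sba: "b\<^sup>\<star> * a = a * b\<^sup>\<star>"
proof -
  have "(a\<^sup>\<star> * b)\<^sup>\<star> = (b * a\<^sup>\<star>)\<^sup>\<star>" using sab by simp
  then show ?thesis by (simp add: star_mult star_star)
qed

private lemma bx: "x * b = b * x"
  using is_core_inverse_commute[OF a, of b] ab sba by simp

private lemma bp: "p * b = b * p"
  unfolding p_def by (simp add: bx mult.assoc mult_eq_assoc[OF ab])

private lemma bq: "q * b = b * q"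
  by (simp add: qdef algebra_simps bp)

text \<open>In the upper left corner this reads \<open>c1 = (a1 c1) x\<close>, the link between
  \<open>a + b\<close> and \<open>c\<close>.\<close>

private lemma sum_x: "p * c = (a + b) * x"
  by (simp add: c_def algebra_simps bx ax mult_eq_assoc[OF bp] px)

private lemma cp: "p * c = c * p" and cx: "x * c = c * x"
  by (simp_all add: c_def algebra_simps bx bp px xp mult_eq_assoc[OF bx] mult_eq_assoc[OF bp])

private lemma cq: "c * q = q" "q * c = q"
  by (simp_all add: c_def algebra_simps bx mult_eq_assoc[OF bq] xq qx)

private lemma Tp: "(a + b) * p = a * p * c" and Tp': "(a + b) * p = c * (a * p)"
  and qT: "q * (a + b) = b * q"
  by (simp_all add: c_def algebra_simps bx bp ax xap qa bq ab mult_eq_assoc[OF ax]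
      mult_eq_assoc[OF ab] mult_eq_assoc[OF bp] mult_eq_assoc[OF bx]
      mult_eq_assoc[OF px] px xp)

section \<open>From the core inverse of \<open>a + b\<close> to that of \<open>c\<close>\<close>

private lemma core_sum_imp:
  assumes Z: "is_core_inverse (a + b) Z" and h: "(1 - x * a) * Z * a = 0"
  shows "\<exists>D. is_core_inverse c D \<and> (1 - D * c) * a * q = 0"
proof -
  define T where "T = a + b"
  have ZTT: "Z * (T * T) = T" and TZZ: "T * (Z * Z) = Z" and ts: "(T * Z)\<^sup>\<star> = T * Z"
    using Z by (auto simp: is_core_inverse_def power2_eq_square T_def)
  have TZT: "T * (Z * T) = T"
    using is_core_inverse_regular[OF Z] by (auto simp: mult.assoc T_def)
  \<comment> \<open>Multiplied by \<open>q\<close> on the left, \<open>h\<close> loses its first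
    factor and leaves \<open>q * Z * p = 0\<close>: \<open>Z\<close> is upper triangular.\<close>
  have "q * (1 - x * a) = q" by (simp add: algebra_simps mult_eq_assoc[OF qx])
  then have "q * (Z * a) = q * (1 - x * a) * Z * a" by (simp add: mult.assoc)
  also have "\<dots> = 0" using h by (simp add: mult.assoc)
  finally have "q * (Z * a) * x = 0" by simp
  then have qZp: "q * (Z * p) = 0" by (simp add: p_def mult.assoc)
  then have pZp: "p * (Z * p) = Z * p" by (simp add: qdef algebra_simps)
  have qTZp: "q * (T * Z * p) = 0"
    by (simp add: T_def mult.assoc mult_eq_assoc[OF qT] qZp)
  then have pTZp: "p * (T * Z * p) = T * Z * p" by (simp add: qdef algebra_simps)
  \<comment> \<open>\<open>T * Z\<close> is upper triangular and self-adjoint, hence block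
    diagonal.\<close>
  have "(q * (T * Z * p))\<^sup>\<star> = p * (T * Z) * q"
    by (simp only: star_mult[of q] star_mult[of _ p] ts qs ps)
  with qTZp have pTZq: "p * (T * Z) * q = 0" by (simp add: star_zero)
  have TZp: "T * Z * p = p * (T * Z)"
    using pTZq pTZp by (simp add: qdef algebra_simps)
  \<comment> \<open>The corner of \<open>Z\<close> should be \<open>x d1\<close>, so
    \<open>d1\<close> is recovered as \<open>a1\<close> times that corner; \<open>q\<close> inverts
    the lower block 1 of \<open>c\<close>.\<close>
  define D where "D = a * Z * p + q"
  have xaZp: "x * (a * (Z * p)) = Z * p"
    using mult_eq_assoc3[OF xap, of "Z * p"] by (simp only: pZp)
  have cD: "c * D = T * Z * p + q"
  proof -
    have "c * D = a * Z * p + b * (x * (a * (Z * p))) + q"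
      by (simp add: D_def distrib_left cq) (simp add: c_def distrib_right bx mult.assoc)
    then show ?thesis by (simp add: xaZp T_def algebra_simps)
  qed
  have "(T * Z * p)\<^sup>\<star> = T * Z * p"
    by (simp only: star_mult[of _ p] ts ps TZp[symmetric])
  then have sD: "(c * D)\<^sup>\<star> = c * D" by (simp add: cD star_add qs)
  have aT: "a * p * (T * p) = T * p * (a * p)"
  proof -
    have "a * p * (T * p) = a * p * (c * (a * p))" by (simp only: T_def Tp')
    also have "\<dots> = T * p * (a * p)" by (simp only: T_def Tp mult.assoc)
    finally show ?thesis .
  qed
  \<comment> \<open>Since \<open>a1\<close> commutes with the corner \<open>a1 c1\<close> of
    \<open>T\<close>, the element \<open>a * Z * p\<close> lies in the range of \<open>T\<close>,
    where \<open>T * Z\<close> acts as the identity.\<close>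
  have aZp: "a * (Z * p) = T * (p * (a * p) * (Z * p * (Z * p)))"
  proof -
    have "a * (Z * p) = a * (T * (Z * Z) * p)" by (simp only: TZZ)
    also have "\<dots> = a * (T * Z * p * (Z * p))" by (simp only: mult.assoc pZp)
    also have "\<dots> = a * (p * (T * Z * p) * (Z * p))" by (simp only: pTZp)
    also have "\<dots> = a * p * (T * p) * (Z * p * (Z * p))"
      by (simp only: mult.assoc mult_eq_assoc3[OF pZp])
    also have "\<dots> = T * (p * (a * p) * (Z * p * (Z * p)))"
      unfolding aT by (simp only: mult.assoc)
    finally show ?thesis .
  qed
  have TZa: "T * (Z * (a * (Z * p))) = a * (Z * p)"
    by (subst (1 2) aZp) (simp add: mult_eq_assoc3[OF TZT])
  have cDD: "c * (D * D) = D"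
  proof -
    have "c * (D * D) = (T * Z * p + q) * D" using cD by (simp add: mult.assoc[symmetric])
    also have "\<dots> = D"
      by (simp add: D_def algebra_simps pq qq mult_eq_assoc[OF pa] mult_eq_assoc[OF qa] TZa)
    finally show ?thesis .
  qed
  have pcx: "p * c * x = x * c"
    by (simp add: cx px mult.assoc mult_eq_assoc[OF cp])
  have Dcc: "D * (c * c) = c"
  proof -
    have "Z * (p * (c * c)) = Z * (T * (x * c))"
      using sum_x by (simp only: T_def mult.assoc[symmetric])
    also have "x * c = p * c * x" by (simp only: pcx)
    also have "p * c * x = T * (x * x)" using sum_x by (simp add: T_def mult.assoc)
    also have "Z * (T * (T * (x * x))) = T * (x * x)" by (rule mult_eq_assoc3[OF ZTT])
    finally have "a * Z * p * (c * c) = a * (p * c * x)"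
      using sum_x by (simp add: T_def mult.assoc)
    also have "\<dots> = p * c" by (simp only: pcx mult_eq_assoc[OF ax])
    finally have 1: "a * Z * p * (c * c) = p * c" .
    have "q * (c * c) = q * c" by (simp add: mult_eq_assoc[OF cq(2)])
    with 1 have "D * (c * c) = (p + q) * c" by (simp add: D_def distrib_right)
    then show ?thesis by (simp add: qdef)
  qed
  have "is_core_inverse c D"
    using Dcc cDD sD by (simp add: is_core_inverse_def power2_eq_square)
  moreover have "(1 - D * c) * a * q = 0"
  proof -
    \<comment> \<open>The off-diagonal block of \<open>T\<close> is \<open>a * q\<close>. As
      \<open>T * Z\<close> fixes \<open>T\<close> and is block diagonal, it fixes
      \<open>a * q\<close>, so \<open>c * D\<close> does too; then \<open>D * (c * c) = c\<close>
      gives the same for \<open>D * c\<close>.\<close>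
    have pTq: "p * T * q = a * q"
      by (simp add: T_def algebra_simps pa mult_eq_assoc[OF pa] bp pq mult_eq_assoc[OF bp])
    have "T * Z * (a * q) = T * Z * p * T * q"
      using pTq by (simp add: mult.assoc)
    also have "\<dots> = p * (T * (Z * T)) * q" unfolding TZp by (simp only: mult.assoc)
    also have "\<dots> = a * q" by (simp only: TZT pTq)
    finally have r: "c * D * (a * q) = a * q"
      by (simp add: cD distrib_right mult.assoc mult_eq_assoc[OF pa] mult_eq_assoc[OF qa])
    have "D * c * (a * q) = D * (c * c) * D * (a * q)"
      by (subst r[symmetric]) (simp only: mult.assoc)
    also have "\<dots> = a * q" using r by (simp only: Dcc)
    finally show ?thesis by (simp add: algebra_simps)
  qed
  ultimately show ?thesis by blast
qed

section \<open>From the core inverse of \<open>c\<close> to that of \<open>a + b\<close>\<close>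

private lemma core_one_plus_imp:
  assumes b: "is_core_inverse b y" and d: "is_core_inverse c d"
    and h: "(1 - d * c) * a * q = 0"
  shows "\<exists>Z. is_core_inverse (a + b) Z \<and> (1 - x * a) * Z * a = 0"
proof -
  define T where "T = a + b"
  have ybb: "y * (b * b) = b" and byy: "b * (y * y) = y" and ys: "(b * y)\<^sup>\<star> = b * y"
    using b by (auto simp: is_core_inverse_def power2_eq_square)
  have dcc: "d * (c * c) = c" and cdd: "c * (d * d) = d" and ds: "(c * d)\<^sup>\<star> = c * d"
    using d by (auto simp: is_core_inverse_def power2_eq_square)
  have cdc: "c * (d * c) = c"
    using is_core_inverse_regular[OF d] by (auto simp: mult.assoc)
  have yq: "q * y = y * q"
    using is_core_inverse_commute[OF b, of q] bq by (simp add: qs)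
  have dp: "p * d = d * p"
    using is_core_inverse_commute[OF d, of p] cp by (simp add: ps)
  \<comment> \<open>Only \<open>d * c\<close> is moved past \<open>x\<close>: to move
    \<open>d\<close> itself, \<open>is_core_inverse_commute\<close> would require the adjoint of
    \<open>x\<close> to commute with \<open>c\<close>.\<close>
  have dcx: "x * (d * c) = d * c * x"
    using is_core_inverse_commute_idem[OF d, of x] cx by simp
  have dca: "d * (c * (a * q)) = a * q"
    using h by (simp add: algebra_simps)
  \<comment> \<open>\<open>c * d\<close> fixes the range of \<open>c\<close>, which contains
    \<open>a * q\<close> because \<open>d * c = c * (d * d) * c\<close>.\<close>
  have cda: "c * (d * (a * q)) = a * q"
  proof -
    have "c * (d * (a * q)) = c * (d * (d * (c * (a * q))))" by (simp only: dca)
    also have "\<dots> = d * (c * (a * q))" by (rule mult_eq_assoc3[OF cdd])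
    finally show ?thesis by (simp only: dca)
  qed
  \<comment> \<open>The block inverse from the introduction: \<open>x * d\<close> already lies in
    the upper left corner, and \<open>q * y\<close> is \<open>y4\<close>. The middle term cancels
    the off-diagonal block of \<open>T * Z\<close>.\<close>
  define Z where "Z = x * d - x * (d * (a * (q * y))) + q * y"
  have Txd: "T * (x * d) = p * (c * d)"
    using sum_x by (simp add: T_def mult.assoc[symmetric])
  have TZ: "T * Z = p * (c * d) + b * y * q"
  proof -
    have "T * (x * (d * (a * (q * y)))) = p * (c * (d * (a * q))) * y"
      using Txd by (simp add: mult.assoc[symmetric])
    also have "\<dots> = a * q * y" by (simp add: cda mult_eq_assoc[OF pa])
    finally show ?thesis
      by (simp add: Z_def algebra_simps Txd) (simp add: T_def algebra_simps yq)
  qed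
  have pr: "p * (c * d) = c * d * p" by (simp add: mult.assoc mult_eq_assoc[OF cp] dp)
  have qr: "q * (b * y) = b * y * q" by (simp add: mult.assoc mult_eq_assoc[OF bq] yq)
  have "(p * (c * d))\<^sup>\<star> = p * (c * d)"
    by (simp only: star_mult[of p] ds ps) (simp only: pr)
  moreover have "(b * y * q)\<^sup>\<star> = b * y * q"
    by (simp only: star_mult[of _ q] ys qs) (simp only: qr)
  ultimately have sT: "(T * Z)\<^sup>\<star> = T * Z" by (simp add: TZ star_add)
  have TZZ: "T * (Z * Z) = Z"
  proof -
    have "x * d = x * (c * (d * d))" by (simp only: cdd)
    also have "\<dots> = c * x * (d * d)" by (simp only: cx mult.assoc[symmetric])
    finally have xd: "x * d = c * (x * (d * d))" by (simp only: mult.assoc)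
    \<comment> \<open>By \<open>xd\<close>, \<open>x * d\<close> lies in the range of
      \<open>c\<close>, which \<open>c * d\<close> fixes.\<close>
    have "p * (c * d) * (x * d) = p * (x * d)"
      unfolding xd by (simp only: mult.assoc mult_eq_assoc3[OF cdc])
    then have e1: "p * (c * (d * (x * d))) = x * d"
      by (simp add: mult.assoc mult_eq_assoc[OF px])
    have e2: "p * (c * (d * (x * (d * w)))) = x * (d * w)" for w
      using arg_cong[OF e1, of "\<lambda>u. u * w"] by (simp add: mult.assoc)
    have e3: "p * (c * (d * (q * y))) = 0"
      by (simp add: mult_eq_assoc3[OF pr] mult.assoc mult_eq_assoc[OF pq])
    have e4: "b * (y * (q * (q * y))) = q * y"
      by (simp add: yq mult_eq_assoc[OF yq] mult.assoc qq mult_eq_assoc3[OF byy])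
    have "T * (Z * Z) = T * Z * Z" by (simp only: mult.assoc)
    also have "\<dots> = Z"
      unfolding TZ
      by (simp add: Z_def algebra_simps e1 e2 e3 e4 mult_eq_assoc[OF qx])
    finally show ?thesis .
  qed
  have ZTT: "Z * (T * T) = T"
  proof -
    have qT': "q * T = b * q" using qT by (simp add: T_def)
    have qyT: "q * y * T = y * b * q"
      by (simp add: yq mult.assoc qT')
    have "y * b * q * T = y * (b * b) * q" using qT' by (simp add: mult.assoc)
    then have ybqT: "y * b * q * T = b * q" by (simp only: ybb)
    have "q * (y * (T * T)) = q * y * T * T" by (simp only: mult.assoc)
    then have qyTT: "q * (y * (T * T)) = b * q" by (simp only: qyT ybqT)
    \<comment> \<open>Splitting the middle by \<open>p + q\<close> separates the part governed by
      \<open>c\<close> from the term \<open>x * d * a * b * q\<close>, which the second summand of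
      \<open>Z\<close> cancels.\<close>
    have "x * d * (T * T) = x * d * (T * p * T) + x * d * T * (q * T)"
      by (simp add: qdef algebra_simps)
    also have "x * d * T * (q * T) = x * d * a * b * q + x * d * b * b * q"
      unfolding qT' by (simp add: T_def algebra_simps)
    also have "x * d * b * b * q = 0"
    proof -
      have "x * d * q = 0" by (simp add: qdef algebra_simps dp[symmetric] mult_eq_assoc[OF xp])
      moreover have "x * d * b * b * q = x * d * q * b * b" by (simp add: mult.assoc bq mult_eq_assoc[OF bq])
      ultimately show ?thesis by simp
    qed
    also have "x * d * (T * p * T) = a + b * p"
    proof -
      have xapT: "x * a * p * T = T * p + a * q"
        by (simp add: mult.assoc mult_eq_assoc3[OF xap])
          (simp add: T_def algebra_simps qdef pa bp)
      have "x * d * (T * p * T) = x * (d * c) * (a * p * T)"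
        using Tp' by (simp add: T_def mult.assoc)
      also have "\<dots> = d * c * (x * a * p * T)" unfolding dcx by (simp only: mult.assoc)
      also have "\<dots> = d * (c * c) * (a * p) + d * (c * (a * q))"
        unfolding xapT using Tp' by (simp add: T_def mult.assoc distrib_left)
      also have "\<dots> = T * p + a * q"
        unfolding dcc dca using Tp' by (simp add: T_def)
      also have "\<dots> = a + b * p" by (simp add: T_def qdef algebra_simps)
      finally show ?thesis .
    qed
    finally have "x * d * (T * T) = a + b * p + x * d * a * b * q" by simp
    then show ?thesis
      by (simp add: Z_def algebra_simps qyTT) (simp add: T_def qdef algebra_simps)
  qed
  have "is_core_inverse (a + b) Z"
    using ZTT TZZ sT by (simp add: is_core_inverse_def power2_eq_square T_def)
  moreover have "(1 - x * a) * Z * a = 0"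
  proof -
    \<comment> \<open>The first two summands of \<open>Z\<close> begin with \<open>x\<close> and are
      killed by \<open>1 - x * a\<close>; the third is killed by \<open>a\<close> on the
      right.\<close>
    have "q * (y * a) = 0" by (simp add: mult_eq_assoc[OF yq] mult.assoc qa)
    moreover have "x * (a * (x * w)) = x * w" for w by (rule mult_eq_assoc3[OF xax])
    ultimately show ?thesis by (simp add: Z_def algebra_simps)
  qed
  ultimately show ?thesis by blast
qed

text \<open>Witnesses replace \<open>core_inv\<close> and the spectral idempotents, so that
  uniqueness of core inverses is left to the final theorem.\<close>

lemma core_sum_iff:
  assumes "core_invertible b"
  shows "(\<exists>Z. is_core_inverse (a + b) Z \<and> (1 - x * a) * Z * a = 0) \<longleftrightarrow>
    (\<exists>D. is_core_inverse (1 + x * b) D \<and> (1 - D * (1 + x * b)) * a * (1 - a * x) = 0)"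
  using core_sum_imp core_one_plus_imp assms
  unfolding core_invertible_def c_def q_def by blast

end

theorem theorem3p4:
  fixes a b :: "'a::complex_banach_star_algebra_1"
  assumes "core_invertible a" and "core_invertible b"
    and "a * b = b * a" and "a\<^sup>\<star> * b = b * a\<^sup>\<star>"
  shows "(core_invertible (a + b) \<and> a\<^sup>\<pi> * core_inv (a + b) * a = 0) \<longleftrightarrow>
    (core_invertible (1 + core_inv a * b) \<and>
      (1 + core_inv a * b)\<^sup>\<pi> * a * (1 - a * core_inv a) = 0)"
proof -
  define x where "x = core_inv a"
  have a: "is_core_inverse a x"
    unfolding x_def by (rule is_core_inverse_core_inv[OF assms(1)])
  have "(core_invertible (a + b) \<and> a\<^sup>\<pi> * core_inv (a + b) * a = 0) \<longleftrightarrow>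
      (\<exists>Z. is_core_inverse (a + b) Z \<and> (1 - x * a) * Z * a = 0)"
    unfolding is_core_inverse_spectral_idem[OF a] core_invertible_def
    using core_inv_eq by blast
  also have "\<dots> \<longleftrightarrow> (\<exists>D. is_core_inverse (1 + x * b) D \<and>
      (1 - D * (1 + x * b)) * a * (1 - a * x) = 0)"
    by (rule core_sum_iff[OF a assms(3,4,2)])
  also have "\<dots> \<longleftrightarrow> (core_invertible (1 + x * b) \<and> (1 + x * b)\<^sup>\<pi> * a * (1 - a * x) = 0)"
    unfolding core_invertible_def using is_core_inverse_spectral_idem by metis
  finally show ?thesis unfolding x_def .
qed

end
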